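(* For every net of conics $\mathcal{L}\subset\mathbb{S}^3$ of type $F^*$, the ML-base locus $\mathbb{P}\mathcal{L}^{-1}\cap\mathbb{P}\mathcal{L}^\perp$ is a reduced point of rank $2$ (i.e. as a scheme it is a single reduced point, which is a matrix of rank $2$), and the ML-degree of $\mathcal{L}$ is $1$.
   Context: Everything is over $\mathbb{C}$. $\mathbb{S}^3$ is the $6$-dimensional space of complex symmetric $3\times 3$ matrices, $\mathbb{P}^5=\mathbb{P}\mathbb{S}^3$. A net of conics is a $3$-dimensional linear subspace of $\mathbb{S}^3$. For a net $\mathcal{L}$ containing an invertible matrix, $\mathbb{P}\mathcal{L}^{-1}\subset\mathbb{P}^5$ is the Zariski closure of $\mathbb{P}(\{A^{-1} \mid A\in\mathcal{L},\ \det A\neq 0\})$. The polar net is $\mathcal{L}^\perp=\{N\in\mathbb{S}^3\mid \mathrm{trace}(MN)=0 \text{ for all } M\in\mathcal{L}\}$. The ML-base locus of $\mathcal{L}$ is the (scheme-theoretic) intersection $\mathbb{P}\mathcal{L}^{-1}\cap\mathbb{P}\mathcal{L}^\perp$. The ML-degree of $\mathcal{L}$ is the number of complex critical points on $\mathcal{L}$ of $\ell_S(M)=\log\det(M)-\mathrm{trace}(SM)$ for a generic matrix $S\in\mathbb{S}^3$; that is, the number of invertible $M\in\mathcal{L}$ with $\mathrm{trace}(M^{-1}N)=\mathrm{trace}(SN)$ for all $N\in\mathcal{L}$. A symmetric matrix $M$ is identified with the quadratic form $(x,y,z)M(x,y,z)^T$; e.g. $2xy$ is the matrix with entries $1$ at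 positions $(1,2),(2,1)$ and $0$ elsewhere. Two nets are congruent if $\mathcal{L}_2=g^T\mathcal{L}_1 g$ for some $g\in \mathrm{GL}(3,\mathbb{C})$. A net is of type $F^*$ if it is congruent to the net spanned by $x^2,\ 2xy,\ y^2+z^2$. *)

theory Defs
  imports "HOL-Analysis.Analysis" "HOL-Library.Poly_Mapping"
begin

section \<open>Symmetric matrices and nets of conics\<close>

type_synonym mat3 = "complex^3^3"

definition Sym3 :: "mat3 set" where
  "Sym3 = {A. transpose A = A}"

definition smat :: "complex \<Rightarrow> mat3 \<Rightarrow> mat3" where
  "smat c A = (\<chi> i j. c * A $ i $ j)"

interpretation cmat: vector_space smat
  by standard (simp_all add: smat_def vec_eq_iff algebra_simps)

definition net_of_conics :: "mat3 set \<Rightarrow> bool" where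
  "net_of_conics L \<longleftrightarrow> cmat.subspace L \<and> L \<subseteq> Sym3 \<and> cmat.dim L = 3"

definition polar_net :: "mat3 set \<Rightarrow> mat3 set" where
  "polar_net L = {N \<in> Sym3. \<forall>M\<in>L. trace (M ** N) = 0}"

definition congruent_nets :: "mat3 set \<Rightarrow> mat3 set \<Rightarrow> bool" where
  "congruent_nets L1 L2 \<longleftrightarrow>
     (\<exists>g :: mat3. invertible g \<and> L2 = (\<lambda>M. transpose g ** M ** g) ` L1)"

text \<open>The spanning matrices are those of the quadratic forms $x^2$, $2xy$ and $y^2+z^2$.\<close>

definition F_star_net :: "mat3 set" where
  "F_star_net = cmat.span
     {vector [vector [1, 0, 0], vector [0, 0, 0], vector [0, 0, 0]],
      vector [vector [0, 1, 0], vector [1, 0, 0], vector [0, 0, 0]],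
      vector [vector [0, 0, 0], vector [0, 1, 0], vector [0, 0, 1]]}"

definition type_F_star :: "mat3 set \<Rightarrow> bool" where
  "type_F_star L \<longleftrightarrow> congruent_nets F_star_net L"


section \<open>The coordinate ring of the space of symmetric matrices\<close>

datatype coord = X11 | X12 | X13 | X22 | X23 | X33

fun entry :: "coord \<Rightarrow> mat3 \<Rightarrow> complex" where
  "entry X11 A = A $ 1 $ 1"
| "entry X12 A = A $ 1 $ 2"
| "entry X13 A = A $ 1 $ 3"
| "entry X22 A = A $ 2 $ 2"
| "entry X23 A = A $ 2 $ 3"
| "entry X33 A = A $ 3 $ 3"

text \<open>The polynomial ring over the complex numbers in the six coordinates: a polynomial is the
  finitely supported map from monomials (exponent vectors) to coefficients, with the
  convolution product of \<^theory>\<open>HOL-Library.Poly_Mapping\<close>.\<close>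

type_synonym cpoly = "(coord \<Rightarrow>\<^sub>0 nat) \<Rightarrow>\<^sub>0 complex"

definition poly_eval :: "cpoly \<Rightarrow> mat3 \<Rightarrow> complex" where
  "poly_eval f A = (\<Sum>m\<in>Poly_Mapping.keys f. Poly_Mapping.lookup f m *
     (\<Prod>v\<in>Poly_Mapping.keys m. entry v A ^ Poly_Mapping.lookup m v))"

definition mon_degree :: "(coord \<Rightarrow>\<^sub>0 nat) \<Rightarrow> nat" where
  "mon_degree m = (\<Sum>v\<in>Poly_Mapping.keys m. Poly_Mapping.lookup m v)"

definition homogeneous_of_degree :: "nat \<Rightarrow> cpoly \<Rightarrow> bool" where
  "homogeneous_of_degree d f \<longleftrightarrow> (\<forall>m\<in>Poly_Mapping.keys f. mon_degree m = d)"

definition homogeneous :: "cpoly \<Rightarrow> bool" where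
  "homogeneous f \<longleftrightarrow> (\<exists>d. homogeneous_of_degree d f)"

definition hom_component :: "nat \<Rightarrow> cpoly \<Rightarrow> cpoly" where
  "hom_component d f = (\<Sum>m\<in>{m \<in> Poly_Mapping.keys f. mon_degree m = d}.
     Poly_Mapping.single m (Poly_Mapping.lookup f m))"

definition poly_ideal :: "cpoly set \<Rightarrow> bool" where
  "poly_ideal I \<longleftrightarrow> 0 \<in> I \<and> (\<forall>f\<in>I. \<forall>g\<in>I. f + g \<in> I) \<and> (\<forall>f\<in>I. \<forall>h. h * f \<in> I)"

definition homogeneous_ideal :: "cpoly set \<Rightarrow> bool" where
  "homogeneous_ideal I \<longleftrightarrow> poly_ideal I \<and> (\<forall>f\<in>I. \<forall>d. hom_component d f \<in> I)"

definition prime_poly_ideal :: "cpoly set \<Rightarrow> bool" where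
  "prime_poly_ideal P \<longleftrightarrow>
     poly_ideal P \<and> 1 \<notin> P \<and> (\<forall>f g. f * g \<in> P \<longrightarrow> f \<in> P \<or> g \<in> P)"

definition irrelevant_ideal :: "cpoly set" where
  "irrelevant_ideal = {f. Poly_Mapping.lookup f 0 = 0}"

definition ideal_sum :: "cpoly set \<Rightarrow> cpoly set \<Rightarrow> cpoly set" where
  "ideal_sum I J = {f + g | f g. f \<in> I \<and> g \<in> J}"


section \<open>Projective 5-space: closed points, Zariski closure\<close>

text \<open>A closed point is the set of all its nonzero representatives.\<close>

definition proj_point :: "mat3 \<Rightarrow> mat3 set" where
  "proj_point A = {smat c A | c. c \<noteq> 0}"

definition proj :: "mat3 set \<Rightarrow> mat3 set set" where
  "proj S = proj_point ` (S - {0})"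

text \<open>A polynomial vanishes on all representatives of a point if and only if all of its
  homogeneous components vanish there, so the following is the homogeneous vanishing ideal.\<close>

definition vanishing_ideal :: "mat3 set set \<Rightarrow> cpoly set" where
  "vanishing_ideal X = {f. \<forall>p\<in>X. \<forall>A\<in>p. poly_eval f A = 0}"

definition zero_locus :: "cpoly set \<Rightarrow> mat3 set set" where
  "zero_locus I = {p \<in> proj Sym3. \<forall>f\<in>I. \<forall>A\<in>p. poly_eval f A = 0}"

definition zariski_closure :: "mat3 set set \<Rightarrow> mat3 set set" where
  "zariski_closure X = zero_locus (vanishing_ideal X)"

definition proj_inverse :: "mat3 set \<Rightarrow> mat3 set set" where
  "proj_inverse L = zariski_closure (proj {matrix_inv A | A. A \<in> L \<and> det A \<noteq> 0})"


section \<open>Closed subschemes of projective 5-space\<close>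

text \<open>Let $S$ be the coordinate ring. A homogeneous ideal $I$ of $S$ presents the closed subscheme
  $\mathrm{Proj}(S/I)$; varieties are presented by their vanishing ideals, and the
  scheme-theoretic intersection of $\mathrm{Proj}(S/I)$ and $\mathrm{Proj}(S/J)$ is
  $\mathrm{Proj}(S/(I+J))$. Points of $\mathrm{Proj}(S/I)$ are given as primes of $S$
  containing $I$.\<close>

definition Proj_points :: "cpoly set \<Rightarrow> cpoly set set" where
  "Proj_points I = {P. prime_poly_ideal P \<and> homogeneous_ideal P \<and> I \<subseteq> P
                      \<and> \<not> irrelevant_ideal \<subseteq> P}"

text \<open>The stalk of $\mathrm{Proj}(S/I)$ at $P$ consists of the fractions $f/g$ with $f$, $g$
  homogeneous of the same degree and $g \notin P$. Such a fraction is zero if and only if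
  $hf \in I$ for some homogeneous $h \notin P$. As $(f/g)^n = f^n/g^n$, the condition for
  nilpotency does not involve $g$ either; and every homogeneous $f$ is a numerator, because some
  coordinate is not in $P$.\<close>

definition zero_in_stalk :: "cpoly set \<Rightarrow> cpoly set \<Rightarrow> cpoly \<Rightarrow> bool" where
  "zero_in_stalk I P f \<longleftrightarrow> (\<exists>h. homogeneous h \<and> h \<notin> P \<and> h * f \<in> I)"

definition reduced_Proj :: "cpoly set \<Rightarrow> bool" where
  "reduced_Proj I \<longleftrightarrow> (\<forall>P\<in>Proj_points I. \<forall>f n. homogeneous f \<longrightarrow>
     zero_in_stalk I P (f ^ n) \<longrightarrow> zero_in_stalk I P f)"

definition is_reduced_point :: "cpoly set \<Rightarrow> mat3 set \<Rightarrow> bool" where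
  "is_reduced_point I p \<longleftrightarrow> Proj_points I = {vanishing_ideal {p}} \<and> reduced_Proj I"

definition ml_base_locus :: "mat3 set \<Rightarrow> cpoly set" where
  "ml_base_locus L =
     ideal_sum (vanishing_ideal (proj_inverse L)) (vanishing_ideal (proj (polar_net L)))"


section \<open>ML-degree\<close>

definition critical_points :: "mat3 set \<Rightarrow> mat3 \<Rightarrow> mat3 set" where
  "critical_points L S =
     {M \<in> L. invertible M \<and> (\<forall>N\<in>L. trace (matrix_inv M ** N) = trace (S ** N))}"

text \<open>Generic means: for all symmetric $S$ outside the zero set of some nonzero polynomial, that is,
  on a nonempty Zariski open subset.\<close>

definition has_ml_degree :: "mat3 set \<Rightarrow> nat \<Rightarrow> bool" where
  "has_ml_degree L d \<longleftrightarrow> (\<exists>q :: cpoly. q \<noteq> 0 \<and>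
     (\<forall>S\<in>Sym3. poly_eval q S \<noteq> 0 \<longrightarrow>
        finite (critical_points L S) \<and> card (critical_points L S) = d))"

end

(*
In the given coordinates of F*, the matrix with parameters a, b, c has adjugate with entries
X11 = c^2, X12 = - b c, X22 = a c, X33 = a c - b^2, X13 = X23 = 0, while X11, X12 and X22 + X33
cut out the polar net.  The linear forms X13, X23, X11, X12, X22 + X33 vanish exactly at
N = diag(0, 1, -1), and N is a limit of inverses (up to scaling), so the ideal of the base locus
is the vanishing ideal of the point N.  The critical equations for S prescribe the entries X11 and
X12 and the sum X22 + X33 of X = M^-1; as X33 = 1/c is X22 - X12^2 / X11, they have one solution.
Both invariants are transported along congruence.
*)

theory Submission
  imports Defs "HOL-Computational_Algebra.Polynomial"
begin

section \<open>Polynomials as sums of monomials\<close>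

text \<open>The base point has rank 2, so it is not an inverse itself; its membership in the closure
  needs a limit along an explicit arc. This membership gives one inclusion: every element of the sum
  of the two ideals vanishes at the point. For the other inclusion, only linear forms have to be
  produced in the sum, because the linear forms vanishing at a point generate its homogeneous ideal.
  Each of them is split into a form vanishing on the inverses and a form vanishing on the polar net.
  The sum is therefore equal to the point ideal, without passing to a saturation, and reducedness
  follows from primality. Congruence is carried out on matrices and on linear functions of matrices.
  The functions are turned into polynomials only at the end, which avoids substitution homomorphisms
  of the polynomial ring.\<close>

lemma UNIV_coord: "(UNIV :: coord set) = {X11, X12, X13, X22, X23, X33}"
  using coord.exhaust by auto

lemma finite_coord [simp]: "finite (A :: coord set)"
proof -
  have "finite (UNIV :: coord set)" by (simp add: UNIV_coord)
  then show ?thesis by (rule finite_subset [OF subset_UNIV])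
qed

lemma entry_smat: "entry v (smat c A) = c * entry v A"
  by (cases v) (simp_all add: smat_def)

text \<open>The product runs over all six coordinates instead of the support of \<open>m\<close>, so
  that multiplicativity in \<open>m\<close> requires no comparison of supports.\<close>

definition mon_eval :: "(coord \<Rightarrow>\<^sub>0 nat) \<Rightarrow> mat3 \<Rightarrow> complex" where
  "mon_eval m A = (\<Prod>v\<in>UNIV. entry v A ^ Poly_Mapping.lookup m v)"

lemma mon_eval_0 [simp]: "mon_eval 0 A = 1"
  by (simp add: mon_eval_def)

lemma mon_eval_add: "mon_eval (m + n) A = mon_eval m A * mon_eval n A"
  by (simp add: mon_eval_def lookup_add power_add prod.distrib)

lemma mon_eval_single: "mon_eval (Poly_Mapping.single v k) A = entry v A ^ k"
proof -
  have "mon_eval (Poly_Mapping.single v k) A = (\<Prod>w\<in>UNIV. if w = v then entry v A ^ k else 1)"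
    unfolding mon_eval_def by (rule prod.cong) (auto simp: lookup_single when_def)
  then show ?thesis by simp
qed

lemma mon_degree_UNIV: "mon_degree m = (\<Sum>v\<in>UNIV. Poly_Mapping.lookup m v)"
  unfolding mon_degree_def by (rule sum.mono_neutral_left) (auto simp: in_keys_iff)

lemma mon_degree_0 [simp]: "mon_degree 0 = 0"
  by (simp add: mon_degree_UNIV)

lemma mon_degree_add: "mon_degree (m + n) = mon_degree m + mon_degree n"
  by (simp add: mon_degree_UNIV lookup_add sum.distrib)

lemma mon_degree_single [simp]: "mon_degree (Poly_Mapping.single v k) = k"
  by (simp add: mon_degree_def)

lemma mon_eval_smat: "mon_eval m (smat c A) = c ^ mon_degree m * mon_eval m A"
  by (simp add: mon_eval_def entry_smat mon_degree_UNIV power_mult_distrib prod.distrib power_sum)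

lemma poly_eval_mon_eval:
  "poly_eval f A = (\<Sum>m\<in>Poly_Mapping.keys f. Poly_Mapping.lookup f m * mon_eval m A)"
proof -
  have "(\<Prod>v\<in>Poly_Mapping.keys m. entry v A ^ Poly_Mapping.lookup m v) = mon_eval m A" for m
    unfolding mon_eval_def by (rule prod.mono_neutral_left) (auto simp: in_keys_iff)
  then show ?thesis by (simp add: poly_eval_def)
qed

text \<open>Polynomials with different supports can be evaluated over one common index set, which is
  what additivity requires.\<close>

lemma poly_eval_superset:
  assumes "finite K" "Poly_Mapping.keys f \<subseteq> K"
  shows "poly_eval f A = (\<Sum>m\<in>K. Poly_Mapping.lookup f m * mon_eval m A)"
  unfolding poly_eval_mon_eval using assms
  by (intro sum.mono_neutral_left) (auto simp: in_keys_iff)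

lemma poly_eval_0 [simp]: "poly_eval 0 A = 0"
  by (simp add: poly_eval_mon_eval)

lemma poly_eval_add: "poly_eval (f + g) A = poly_eval f A + poly_eval g A"
proof -
  let ?K = "Poly_Mapping.keys f \<union> Poly_Mapping.keys g"
  have "finite ?K" "Poly_Mapping.keys (f + g) \<subseteq> ?K"
    by (simp_all add: Poly_Mapping.keys_add)
  then show ?thesis
    by (simp add: poly_eval_superset [of ?K] lookup_add distrib_right sum.distrib)
qed

lemma poly_eval_sum: "poly_eval (\<Sum>i\<in>I. f i) A = (\<Sum>i\<in>I. poly_eval (f i) A)"
  by (induction I rule: infinite_finite_induct) (simp_all add: poly_eval_add)

lemma poly_eval_single [simp]: "poly_eval (Poly_Mapping.single m c) A = c * mon_eval m A"
  by (simp add: poly_eval_mon_eval)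

lemma poly_eval_1 [simp]: "poly_eval 1 A = 1"
  using poly_eval_single [of 0 1 A] by simp

lemma poly_eq_sum_monomials:
  fixes f :: cpoly
  shows "f = (\<Sum>m\<in>Poly_Mapping.keys f. Poly_Mapping.single m (Poly_Mapping.lookup f m))"
proof (rule poly_mapping_eqI)
  fix k
  show "Poly_Mapping.lookup f k =
    Poly_Mapping.lookup (\<Sum>m\<in>Poly_Mapping.keys f. Poly_Mapping.single m (Poly_Mapping.lookup f m)) k"
    by (simp add: lookup_sum lookup_single when_def in_keys_iff)
qed

lemma poly_eval_mult: "poly_eval (f * g) A = poly_eval f A * poly_eval g A"
proof -
  have *: "poly_eval (Poly_Mapping.single m c * g) A = c * mon_eval m A * poly_eval g A" for m c
  proof -
    have "Poly_Mapping.single m c * g = Poly_Mapping.single m c *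
      (\<Sum>n\<in>Poly_Mapping.keys g. Poly_Mapping.single n (Poly_Mapping.lookup g n))"
      by (metis poly_eq_sum_monomials)
    also have "poly_eval \<dots> A = c * mon_eval m A * poly_eval g A"
      by (simp add: sum_distrib_left poly_eval_sum mult_single mon_eval_add
          poly_eval_mon_eval [of g] mult_ac)
    finally show ?thesis .
  qed
  have "f * g = (\<Sum>m\<in>Poly_Mapping.keys f. Poly_Mapping.single m (Poly_Mapping.lookup f m)) * g"
    by (metis poly_eq_sum_monomials)
  also have "poly_eval \<dots> A = poly_eval f A * poly_eval g A"
    by (simp add: sum_distrib_right poly_eval_sum * poly_eval_mon_eval [of f])
  finally show ?thesis .
qed

lemma poly_eval_diff: "poly_eval (f - g) A = poly_eval f A - poly_eval g A"
  by (metis poly_eval_add add_diff_cancel_right' diff_add_cancel)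

lemma poly_eval_power: "poly_eval (f ^ n) A = poly_eval f A ^ n"
  by (induction n) (simp_all add: poly_eval_mult)

text \<open>This lets a polynomial equation valid along an arc pass to the limit point of the
  arc.\<close>

lemma continuous_poly_eval:
  assumes "\<And>i j. continuous F (\<lambda>t. K t $ i $ j)"
  shows "continuous F (\<lambda>t. poly_eval f (K t))"
proof -
  have "continuous F (\<lambda>t. entry v (K t))" for v
    by (cases v) (simp_all add: assms)
  then show ?thesis
    unfolding poly_eval_mon_eval mon_eval_def by (intro continuous_intros)
qed


section \<open>Homogeneous components\<close>

lemma homogeneous_hom_component: "homogeneous_of_degree d (hom_component d f)"
  unfolding homogeneous_of_degree_def hom_component_def
  using keys_sum [of "\<lambda>m. Poly_Mapping.single m (Poly_Mapping.lookup f m)"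
      "{m \<in> Poly_Mapping.keys f. mon_degree m = d}"]
  by (fastforce split: if_splits)

lemma sum_hom_component: "(\<Sum>d\<in>mon_degree ` Poly_Mapping.keys f. hom_component d f) = f"
proof -
  have "(\<Sum>d\<in>mon_degree ` Poly_Mapping.keys f. hom_component d f) =
    (\<Sum>m\<in>Poly_Mapping.keys f. Poly_Mapping.single m (Poly_Mapping.lookup f m))"
    unfolding hom_component_def by (rule sum.image_gen [symmetric]) simp
  then show ?thesis using poly_eq_sum_monomials [of f] by simp
qed

lemma hom_component_eq_0:
  assumes "d \<notin> mon_degree ` Poly_Mapping.keys f"
  shows "hom_component d f = 0"
proof -
  have "{m \<in> Poly_Mapping.keys f. mon_degree m = d} = {}" using assms by auto
  then show ?thesis unfolding hom_component_def by (simp only: sum.empty)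
qed

lemma poly_eval_smat_homogeneous:
  assumes "homogeneous_of_degree d f"
  shows "poly_eval f (smat c A) = c ^ d * poly_eval f A"
  using assms unfolding homogeneous_of_degree_def poly_eval_mon_eval
  by (simp add: mon_eval_smat sum_distrib_left mult_ac)

text \<open>The restriction of a polynomial to the line through \<open>0\<close> and \<open>A\<close>.\<close>

definition line_poly :: "cpoly \<Rightarrow> mat3 \<Rightarrow> complex poly" where
  "line_poly f A = (\<Sum>d\<in>mon_degree ` Poly_Mapping.keys f. monom (poly_eval (hom_component d f) A) d)"

lemma poly_line_poly: "poly (line_poly f A) c = poly_eval f (smat c A)"
proof -
  have "poly_eval f (smat c A) =
    (\<Sum>d\<in>mon_degree ` Poly_Mapping.keys f. poly_eval (hom_component d f) (smat c A))"
    by (metis poly_eval_sum sum_hom_component)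
  then show ?thesis
    by (simp add: line_poly_def poly_sum poly_monom mult.commute
        poly_eval_smat_homogeneous [OF homogeneous_hom_component])
qed

lemma coeff_line_poly: "coeff (line_poly f A) d = poly_eval (hom_component d f) A"
  by (simp add: line_poly_def coeff_sum hom_component_eq_0)

text \<open>The scalar 0 is excluded because 0 does not represent a projective point; infinitely
  many roots remain.\<close>

lemma poly_eq_0_if_zero_off_0:
  fixes p :: "complex poly"
  assumes "\<And>c. c \<noteq> 0 \<Longrightarrow> poly p c = 0"
  shows "p = 0"
proof (rule ccontr)
  assume "p \<noteq> 0"
  then have "finite {c. poly p c = 0}" by (rule poly_roots_finite)
  then have "finite (insert 0 {c. poly p c = 0})" by simp
  moreover have "insert 0 {c. poly p c = 0} = (UNIV :: complex set)" using assms by auto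
  ultimately show False using infinite_UNIV_char_0 by metis
qed


section \<open>The homogeneous ideal of a point\<close>

lemma vanishing_ideal_point:
  "f \<in> vanishing_ideal {proj_point A} \<longleftrightarrow> (\<forall>c. c \<noteq> 0 \<longrightarrow> poly_eval f (smat c A) = 0)"
  by (auto simp: vanishing_ideal_def proj_point_def)

lemma vanishing_ideal_point_line:
  "f \<in> vanishing_ideal {proj_point A} \<longleftrightarrow> line_poly f A = 0"
  unfolding vanishing_ideal_point using poly_eq_0_if_zero_off_0 [of "line_poly f A"]
  by (auto simp flip: poly_line_poly)

lemma vanishing_ideal_point_hom_component:
  "f \<in> vanishing_ideal {proj_point A} \<longleftrightarrow> (\<forall>d. poly_eval (hom_component d f) A = 0)"
  by (simp add: vanishing_ideal_point_line poly_eq_iff coeff_line_poly)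

lemma poly_ideal_vanishing_ideal: "poly_ideal (vanishing_ideal X)"
  by (simp add: poly_ideal_def vanishing_ideal_def poly_eval_add poly_eval_mult)

text \<open>Restriction to the line through \<open>A\<close> is multiplicative, the point ideal is
  its kernel, and univariate polynomials over a field have no zero divisors.\<close>

lemma prime_vanishing_ideal_point: "prime_poly_ideal (vanishing_ideal {proj_point A})"
proof -
  have "f \<in> vanishing_ideal {proj_point A} \<or> g \<in> vanishing_ideal {proj_point A}"
    if "f * g \<in> vanishing_ideal {proj_point A}" for f g
  proof -
    have "line_poly f A * line_poly g A = 0"
      using that unfolding vanishing_ideal_point
      by (intro poly_eq_0_if_zero_off_0) (simp add: poly_line_poly poly_eval_mult)
    then show ?thesis by (simp add: vanishing_ideal_point_line)
  qed
  moreover have "1 \<notin> vanishing_ideal {proj_point A}"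
    unfolding vanishing_ideal_point by (auto intro: exI [of _ 1])
  ultimately show ?thesis
    unfolding prime_poly_ideal_def using poly_ideal_vanishing_ideal by blast
qed

lemma homogeneous_vanishing_ideal_point: "homogeneous_ideal (vanishing_ideal {proj_point A})"
proof -
  have "hom_component d f \<in> vanishing_ideal {proj_point A}"
    if "f \<in> vanishing_ideal {proj_point A}" for f d
    using that unfolding vanishing_ideal_point_hom_component [of f]
    by (simp add: vanishing_ideal_point poly_eval_smat_homogeneous [OF homogeneous_hom_component])
  then show ?thesis
    unfolding homogeneous_ideal_def using poly_ideal_vanishing_ideal by blast
qed

section \<open>Ideals and congruences modulo linear forms\<close>

abbreviation cvar :: "coord \<Rightarrow> cpoly" where
  "cvar v \<equiv> Poly_Mapping.single (Poly_Mapping.single v 1) 1"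

abbreviation cconst :: "complex \<Rightarrow> cpoly" where
  "cconst c \<equiv> Poly_Mapping.single 0 c"

lemma poly_ideal_mult_left: "poly_ideal I \<Longrightarrow> f \<in> I \<Longrightarrow> h * f \<in> I"
  by (auto simp: poly_ideal_def)

lemma poly_ideal_sum: "poly_ideal I \<Longrightarrow> (\<And>i. i \<in> K \<Longrightarrow> f i \<in> I) \<Longrightarrow> (\<Sum>i\<in>K. f i) \<in> I"
  by (induction K rule: infinite_finite_induct) (auto simp: poly_ideal_def)

lemma poly_ideal_add: "poly_ideal I \<Longrightarrow> f \<in> I \<Longrightarrow> g \<in> I \<Longrightarrow> f + g \<in> I"
  by (auto simp: poly_ideal_def)

lemma poly_ideal_diff: "poly_ideal I \<Longrightarrow> f \<in> I \<Longrightarrow> g \<in> I \<Longrightarrow> f - g \<in> I"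
  using poly_ideal_add [of I f "- 1 * g"] poly_ideal_mult_left [of I g "- 1"] by simp

lemma poly_ideal_power_prime:
  "prime_poly_ideal P \<Longrightarrow> f ^ n \<in> P \<Longrightarrow> f \<in> P"
  by (induction n) (auto simp: prime_poly_ideal_def)

lemma poly_ideal_ideal_sum:
  assumes I: "poly_ideal I" and J: "poly_ideal J"
  shows "poly_ideal (ideal_sum I J)"
proof -
  have "(f + g) + (f' + g') \<in> ideal_sum I J" if "f \<in> I" "g \<in> J" "f' \<in> I" "g' \<in> J" for f g f' g'
  proof -
    have "f + f' \<in> I" "g + g' \<in> J" using that I J by (auto intro: poly_ideal_add)
    moreover have "(f + g) + (f' + g') = (f + f') + (g + g')" by (simp add: algebra_simps)
    ultimately show ?thesis unfolding ideal_sum_def by blast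
  qed
  moreover have "h * (f + g) \<in> ideal_sum I J" if "f \<in> I" "g \<in> J" for f g h
  proof -
    have "h * f \<in> I" "h * g \<in> J" using that I J by (auto intro: poly_ideal_mult_left)
    then show ?thesis unfolding ideal_sum_def distrib_left by blast
  qed
  moreover have "0 \<in> ideal_sum I J"
    using I J unfolding ideal_sum_def poly_ideal_def by (metis (mono_tags, lifting) add_0 mem_Collect_eq)
  ultimately show ?thesis unfolding poly_ideal_def by (auto simp: ideal_sum_def)
qed

text \<open>Congruences modulo an ideal can be multiplied, so the assumed ones for the variables
  propagate to all monomials, with one factor \<open>l\<close> for each variable.\<close>

lemma mon_eval_cong_ideal:
  assumes J: "poly_ideal J" and gen: "\<And>v. cvar v - cconst (entry v A) * l \<in> J"
  shows "Poly_Mapping.single m 1 - cconst (mon_eval m A) * l ^ mon_degree m \<in> J"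
    (is "?P m")
proof -
  have 0: "?P 0" using J by (simp add: poly_ideal_def)
  have add: "?P (m + n)" if "?P m" "?P n" for m n
  proof -
    let ?a = "Poly_Mapping.single m 1 :: cpoly" and ?b = "Poly_Mapping.single n 1 :: cpoly"
    let ?a' = "cconst (mon_eval m A) * l ^ mon_degree m"
    let ?b' = "cconst (mon_eval n A) * l ^ mon_degree n"
    have "?b * (?a - ?a') + ?a' * (?b - ?b') \<in> J"
      using J that by (intro poly_ideal_add poly_ideal_mult_left)
    moreover have "?b * (?a - ?a') + ?a' * (?b - ?b') = ?a * ?b - ?a' * ?b'"
      by (simp add: algebra_simps)
    moreover have "?a * ?b = Poly_Mapping.single (m + n) 1" by (simp add: mult_single)
    moreover have "?a' * ?b' = cconst (mon_eval (m + n) A) * l ^ mon_degree (m + n)"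
    proof -
      have "cconst (mon_eval (m + n) A) = cconst (mon_eval m A) * cconst (mon_eval n A)"
        by (simp add: mult_single mon_eval_add)
      then show ?thesis by (simp add: mon_degree_add power_add mult_ac)
    qed
    ultimately show ?thesis by simp
  qed
  have single: "?P (Poly_Mapping.single v k)" for v k
  proof (induction k)
    case 0
    then show ?case using \<open>?P 0\<close> by simp
  next
    case (Suc k)
    have "?P (Poly_Mapping.single v 1)" using gen [of v] by (simp add: mon_eval_single)
    from add [OF this Suc] show ?case by (simp flip: single_add)
  qed
  show ?thesis
  proof (induction m rule: update_induct)
    case const
    then show ?case by (rule 0)
  next
    case (update f a b)
    \<comment> \<open>The induction only updates a key \<open>a\<close> outside the support of
      \<open>f\<close>, so the update is a sum of exponent vectors and \<open>add\<close>
      applies.\<close>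
    have "Poly_Mapping.update a b f = f + Poly_Mapping.single a b"
      using update(1) by (intro poly_mapping_eqI)
        (auto simp: lookup_update lookup_add lookup_single when_def in_keys_iff)
    then show ?case using add [OF update(3) single] by simp
  qed
qed

text \<open>Modulo the linear forms vanishing at \<open>A\<close>, every coordinate is a scalar multiple of a linear
  form \<open>l\<close>, so a form of degree \<open>d\<close> is its value at \<open>A\<close> times \<open>l ^ d\<close>.\<close>

lemma homogeneous_cong_ideal:
  assumes J: "poly_ideal J" and gen: "\<And>v. cvar v - cconst (entry v A) * l \<in> J"
    and f: "homogeneous_of_degree d f"
  shows "f - cconst (poly_eval f A) * l ^ d \<in> J"
proof -
  let ?c = "Poly_Mapping.lookup f"
  let ?D = "\<lambda>m. Poly_Mapping.single m 1 - cconst (mon_eval m A) * l ^ mon_degree m"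
  have cconst_sum: "cconst (\<Sum>i\<in>K. x i) = (\<Sum>i\<in>K. cconst (x i))" for K and x :: "(coord \<Rightarrow>\<^sub>0 nat) \<Rightarrow> complex"
    by (induction K rule: infinite_finite_induct) (simp_all add: single_add)
  have "(\<Sum>m\<in>Poly_Mapping.keys f. cconst (?c m) * ?D m) \<in> J"
    using J mon_eval_cong_ideal [OF J gen] by (intro poly_ideal_sum poly_ideal_mult_left)
  moreover have "(\<Sum>m\<in>Poly_Mapping.keys f. cconst (?c m) * ?D m) =
    (\<Sum>m\<in>Poly_Mapping.keys f. Poly_Mapping.single m (?c m) - cconst (?c m * mon_eval m A) * l ^ d)"
  proof (rule sum.cong)
    fix m assume "m \<in> Poly_Mapping.keys f"
    then have d: "mon_degree m = d" using f by (simp add: homogeneous_of_degree_def)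
    have "cconst (?c m) * ?D m =
      cconst (?c m) * Poly_Mapping.single m 1 - (cconst (?c m) * cconst (mon_eval m A)) * l ^ d"
      by (simp only: d right_diff_distrib mult.assoc)
    then show "cconst (?c m) * ?D m =
      Poly_Mapping.single m (?c m) - cconst (?c m * mon_eval m A) * l ^ d"
      by (simp add: mult_single)
  qed simp
  moreover have "\<dots> = f - cconst (poly_eval f A) * l ^ d"
    by (simp only: sum_subtractf cconst_sum poly_eval_mon_eval sum_distrib_right
        flip: poly_eq_sum_monomials)
  ultimately show ?thesis by simp
qed

text \<open>A form of degree \<open>d\<close> that is zero at \<open>A\<close> is congruent to
  \<open>0 * l ^ d\<close>, so it lies in \<open>J\<close>; a polynomial in the point ideal has only
  such components.\<close>

lemma vanishing_ideal_point_subset: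
  assumes J: "poly_ideal J" and gen: "\<And>v. cvar v - cconst (entry v A) * l \<in> J"
  shows "vanishing_ideal {proj_point A} \<subseteq> J"
proof
  fix f assume "f \<in> vanishing_ideal {proj_point A}"
  then have "poly_eval (hom_component d f) A = 0" for d
    by (simp add: vanishing_ideal_point_hom_component)
  then have "hom_component d f \<in> J" for d
    using homogeneous_cong_ideal [OF J gen homogeneous_hom_component, of d f] by simp
  then show "f \<in> J" by (metis J poly_ideal_sum sum_hom_component)
qed

section \<open>Linear forms and coordinates of symmetric matrices\<close>

lemma entry_add: "entry v (A + B) = entry v A + entry v B"
  by (cases v) simp_all

lemma Sym3_iff:
  "A \<in> Sym3 \<longleftrightarrow> A $ 2 $ 1 = A $ 1 $ 2 \<and> A $ 3 $ 1 = A $ 1 $ 3 \<and> A $ 3 $ 2 = A $ 2 $ 3"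
  by (auto simp: Sym3_def transpose_def vec_eq_iff forall_3)

lemma Sym3_eq_0_iff:
  assumes "A \<in> Sym3"
  shows "A = 0 \<longleftrightarrow> (\<forall>v. entry v A = 0)"
proof
  assume "\<forall>v. entry v A = 0"
  then have "entry v A = 0" for v by blast
  from this [of X11] this [of X12] this [of X13] this [of X22] this [of X23] this [of X33]
  show "A = 0" using assms by (simp add: Sym3_iff vec_eq_iff forall_3)
next
  assume "A = 0"
  then have "entry v A = 0" for v by (cases v) simp_all
  then show "\<forall>v. entry v A = 0" ..
qed

text \<open>A property of functions instead of polynomials, so that it also covers a matrix entry,
  or a polynomial evaluated after a congruence.\<close>

definition linear_form :: "(mat3 \<Rightarrow> complex) \<Rightarrow> bool" where
  "linear_form F \<longleftrightarrow> (\<forall>A B. F (A + B) = F A + F B) \<and> (\<forall>c A. F (smat c A) = c * F A)"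

lemma linear_form_add: "linear_form F \<Longrightarrow> F (A + B) = F A + F B"
  and linear_form_smat: "linear_form F \<Longrightarrow> F (smat c A) = c * F A"
  by (simp_all add: linear_form_def)

text \<open>A coordinate that is nonzero at \<open>A\<close>, rescaled. Modulo the point ideal,
  \<open>l\<close> becomes the only remaining variable.\<close>

lemma ex_linear_form_eq_1:
  assumes "A \<in> Sym3" "A \<noteq> 0"
  obtains l where "linear_form (poly_eval l)" "poly_eval l A = 1"
proof -
  obtain v where v: "entry v A \<noteq> 0" using assms Sym3_eq_0_iff by blast
  let ?l = "cconst (1 / entry v A) * cvar v"
  have "linear_form (poly_eval ?l)"
    by (simp add: linear_form_def poly_eval_mult mon_eval_single entry_smat entry_add
        add_divide_distrib)
  moreover have "poly_eval ?l A = 1"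
    using v by (simp add: poly_eval_mult mon_eval_single)
  ultimately show ?thesis by (rule that)
qed

lemma cvar_cong_in_vanishing_ideal:
  assumes "linear_form (poly_eval l)" "poly_eval l A = 1"
  shows "cvar v - cconst (entry v A) * l \<in> vanishing_ideal {proj_point A}"
  using assms by (simp add: vanishing_ideal_point poly_eval_diff poly_eval_mult
      mon_eval_smat mon_eval_single linear_form_smat)

section \<open>Homogeneous primes above the ideal of a point\<close>

lemma irrelevant_subset:
  assumes P: "poly_ideal P" and v: "\<And>v. cvar v \<in> P"
  shows "irrelevant_ideal \<subseteq> P"
proof
  fix f assume f: "f \<in> irrelevant_ideal"
  have "Poly_Mapping.single m (Poly_Mapping.lookup f m) \<in> P" if "m \<in> Poly_Mapping.keys f" for m
  proof -
    have "m \<noteq> 0" using f that by (auto simp: irrelevant_ideal_def in_keys_iff)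
    then obtain w where "w \<in> Poly_Mapping.keys m" by (metis all_not_in_conv keys_eq_empty)
    \<comment> \<open>Subtraction of exponents is truncated, but \<open>w\<close> occurs in
      \<open>m\<close>, so nothing is lost.\<close>
    then have "m = (m - Poly_Mapping.single w 1) + Poly_Mapping.single w 1"
      by (intro poly_mapping_eqI) (auto simp: lookup_add lookup_minus lookup_single when_def in_keys_iff)
    then have "Poly_Mapping.single m (Poly_Mapping.lookup f m) =
      Poly_Mapping.single (m - Poly_Mapping.single w 1) (Poly_Mapping.lookup f m) * cvar w"
      by (simp add: mult_single)
    then show ?thesis using P v by (simp add: poly_ideal_mult_left)
  qed
  then have "(\<Sum>m\<in>Poly_Mapping.keys f. Poly_Mapping.single m (Poly_Mapping.lookup f m)) \<in> P"
    using P by (intro poly_ideal_sum)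
  then show "f \<in> P" using poly_eq_sum_monomials [of f] by simp
qed

text \<open>Modulo the point ideal the polynomial ring is a polynomial ring in \<open>l\<close>
  alone. A strictly larger homogeneous prime contains a nonzero multiple of some
  \<open>l ^ d\<close>, hence \<open>l\<close>, hence every variable, so it contains the irrelevant
  ideal.\<close>

lemma Proj_points_vanishing_ideal_point:
  assumes A: "A \<in> Sym3" "A \<noteq> 0"
  shows "Proj_points (vanishing_ideal {proj_point A}) = {vanishing_ideal {proj_point A}}"
proof -
  let ?V = "vanishing_ideal {proj_point A}"
  obtain l where l: "linear_form (poly_eval l)" "poly_eval l A = 1"
    using ex_linear_form_eq_1 [OF A] .
  have gen: "cvar v - cconst (entry v A) * l \<in> ?V" for v
    using l by (rule cvar_cong_in_vanishing_ideal)
  have "\<not> irrelevant_ideal \<subseteq> ?V"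
  proof
    assume "irrelevant_ideal \<subseteq> ?V"
    moreover have "cvar v \<in> irrelevant_ideal" for v
    proof -
      have "Poly_Mapping.single v (1::nat) \<noteq> 0"
        by (metis insert_not_empty keys_eq_empty keys_single one_neq_zero)
      then show ?thesis by (simp add: irrelevant_ideal_def lookup_single when_def)
    qed
    ultimately have V: "cvar v \<in> ?V" for v by auto
    have V1: "poly_eval h A = 0" if "h \<in> ?V" for h
      using that vanishing_ideal_point [of h A] by (metis cmat.scale_one one_neq_zero)
    have "entry v A = 0" for v
      using V1 [OF V [of v]] by (simp add: mon_eval_single)
    then show False using A Sym3_eq_0_iff by blast
  qed
  then have "?V \<in> Proj_points ?V"
    by (simp add: Proj_points_def prime_vanishing_ideal_point homogeneous_vanishing_ideal_point)
  moreover have "P = ?V" if P: "P \<in> Proj_points ?V" for P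
  proof (rule ccontr)
    assume "P \<noteq> ?V"
    have prime: "prime_poly_ideal P" and hom: "homogeneous_ideal P" and sub: "?V \<subseteq> P"
      and irr: "\<not> irrelevant_ideal \<subseteq> P"
      using P by (auto simp: Proj_points_def)
    have ideal: "poly_ideal P" using hom by (simp add: homogeneous_ideal_def)
    obtain f where f: "f \<in> P" "f \<notin> ?V" using \<open>P \<noteq> ?V\<close> sub by blast
    then obtain d where d: "poly_eval (hom_component d f) A \<noteq> 0" (is "?e \<noteq> 0")
      by (auto simp: vanishing_ideal_point_hom_component)
    have "hom_component d f - cconst ?e * l ^ d \<in> P"
      using homogeneous_cong_ideal [OF poly_ideal_vanishing_ideal gen homogeneous_hom_component] sub
      by blast
    moreover have "hom_component d f \<in> P" using hom f(1) by (simp add: homogeneous_ideal_def)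
    ultimately have "cconst ?e * l ^ d \<in> P" using poly_ideal_diff [OF ideal] by fastforce
    then have "cconst (1 / ?e) * (cconst ?e * l ^ d) \<in> P"
      by (rule poly_ideal_mult_left [OF ideal])
    moreover have "cconst (1 / ?e) * (cconst ?e * l ^ d) = l ^ d"
      using d by (simp add: mult_single flip: mult.assoc)
    ultimately have "l ^ d \<in> P" by (simp only:)
    then have "l \<in> P" using prime by (rule poly_ideal_power_prime [rotated])
    have "cvar v \<in> P" for v
    proof -
      have "(cvar v - cconst (entry v A) * l) + cconst (entry v A) * l \<in> P"
        using ideal gen sub \<open>l \<in> P\<close> by (intro poly_ideal_add poly_ideal_mult_left) auto
      then show ?thesis by simp
    qed
    with irrelevant_subset [OF ideal] irr show False by blast
  qed
  ultimately show ?thesis by blast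
qed

text \<open>At the point \<open>I\<close> itself, \<open>h * f ^ n\<close> in \<open>I\<close> with
  \<open>h\<close> outside the prime \<open>I\<close> forces \<open>f\<close> into \<open>I\<close>;
  the multiplier 1 then witnesses that \<open>f\<close> is zero in the stalk.\<close>

lemma reduced_prime_point:
  assumes "prime_poly_ideal I" "Proj_points I = {I}"
  shows "reduced_Proj I"
proof -
  have "1 * f \<in> I" if "h \<notin> I" "h * f ^ n \<in> I" for f h n
    using assms(1) that poly_ideal_power_prime [OF assms(1), of f n]
    by (auto simp: prime_poly_ideal_def)
  moreover have "homogeneous 1" "1 \<notin> I"
    using assms(1) by (auto simp: homogeneous_def homogeneous_of_degree_def prime_poly_ideal_def)
  ultimately show ?thesis
    using assms(2) unfolding reduced_Proj_def zero_in_stalk_def by blast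
qed

lemma is_reduced_point_vanishing_ideal:
  assumes "A \<in> Sym3" "A \<noteq> 0"
  shows "is_reduced_point (vanishing_ideal {proj_point A}) (proj_point A)"
  unfolding is_reduced_point_def
  by (simp add: Proj_points_vanishing_ideal_point [OF assms] prime_vanishing_ideal_point
      reduced_prime_point)


section \<open>Linear forms as polynomials\<close>

text \<open>The basis of the symmetric matrices dual to the coordinates
  \<open>entry\<close>.\<close>

fun coord_basis :: "coord \<Rightarrow> mat3" where
  "coord_basis X11 = vector [vector [1, 0, 0], vector [0, 0, 0], vector [0, 0, 0]]"
| "coord_basis X12 = vector [vector [0, 1, 0], vector [1, 0, 0], vector [0, 0, 0]]"
| "coord_basis X13 = vector [vector [0, 0, 1], vector [0, 0, 0], vector [1, 0, 0]]"
| "coord_basis X22 = vector [vector [0, 0, 0], vector [0, 1, 0], vector [0, 0, 0]]"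
| "coord_basis X23 = vector [vector [0, 0, 0], vector [0, 0, 1], vector [0, 1, 0]]"
| "coord_basis X33 = vector [vector [0, 0, 0], vector [0, 0, 0], vector [0, 0, 1]]"

lemma Sym3_expand:
  assumes "A \<in> Sym3"
  shows "A = (\<Sum>v\<in>UNIV. smat (entry v A) (coord_basis v))"
  using assms by (simp add: UNIV_coord Sym3_iff smat_def vec_eq_iff forall_3)

lemma linear_form_sum:
  assumes "linear_form F"
  shows "F (\<Sum>i\<in>I. A i) = (\<Sum>i\<in>I. F (A i))"
proof -
  have "F 0 = 0" using linear_form_add [OF assms, of 0 0] by simp
  then show ?thesis
    by (induction I rule: infinite_finite_induct) (simp_all add: linear_form_add [OF assms])
qed

text \<open>Agreement is claimed on \<open>Sym3\<close> only: a polynomial sees the upper triangle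
  of \<open>A\<close>, whereas \<open>F\<close> may read all nine entries.\<close>

lemma ex_poly_linear_form:
  assumes "linear_form F"
  obtains l where "\<And>A. A \<in> Sym3 \<Longrightarrow> poly_eval l A = F A"
proof -
  let ?l = "\<Sum>v\<in>UNIV. cconst (F (coord_basis v)) * cvar v"
  have "poly_eval ?l A = F A" if "A \<in> Sym3" for A
  proof -
    have "F A = F (\<Sum>v\<in>UNIV. smat (entry v A) (coord_basis v))"
      using Sym3_expand [OF that] by simp
    also have "\<dots> = poly_eval ?l A"
      by (simp add: linear_form_sum [OF assms] linear_form_smat [OF assms] poly_eval_sum
          poly_eval_mult mon_eval_single mult.commute)
    finally show ?thesis by simp
  qed
  then show ?thesis by (rule that)
qed


section \<open>Congruence of symmetric matrices\<close>

lemma matrix_inv_eqI: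
  fixes A :: "'a::field^'n^'n"
  assumes "A ** B = mat 1"
  shows "matrix_inv A = B"
proof -
  have "A ** B = mat 1 \<and> B ** A = mat 1" using assms matrix_left_right_inverse by blast
  then have "A ** matrix_inv A = mat 1 \<and> matrix_inv A ** A = mat 1"
    unfolding matrix_inv_def by (rule someI)
  then have "matrix_inv A ** (A ** B) = B" by (simp add: matrix_mul_assoc)
  with assms show ?thesis by simp
qed

lemma matrix_inv_right: "invertible A \<Longrightarrow> A ** matrix_inv A = mat 1"
  and matrix_inv_left: "invertible A \<Longrightarrow> matrix_inv A ** A = mat 1"
  for A :: "'a::field^'n^'n"
  by (metis invertible_right_inverse matrix_inv_eqI,
      metis invertible_right_inverse matrix_inv_eqI matrix_left_right_inverse)

lemma inverse_Sym3:
  assumes "A \<in> Sym3" "A ** B = mat 1"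
  shows "B \<in> Sym3"
proof -
  have "transpose B ** A = mat 1"
    using assms by (metis (mono_tags, lifting) Sym3_def matrix_transpose_mul mem_Collect_eq transpose_mat)
  then have "transpose B ** (A ** B) = B" by (simp add: matrix_mul_assoc)
  with assms(2) show ?thesis by (simp add: Sym3_def)
qed

lemma congruent_Sym3: "A \<in> Sym3 \<Longrightarrow> transpose h ** A ** h \<in> Sym3"
  by (simp add: Sym3_def matrix_transpose_mul matrix_mul_assoc)

lemma congruent_Sym3': "A \<in> Sym3 \<Longrightarrow> h ** A ** transpose h \<in> Sym3"
  using congruent_Sym3 [of A "transpose h"] by simp

lemma smat_mult: "smat c A ** B = smat c (A ** B)" "A ** smat c B = smat c (A ** B)"
  by (simp_all add: smat_def matrix_matrix_mult_def vec_eq_iff sum_distrib_left mult_ac)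

lemma matrix_add_rdistrib': "A ** (B + C) = A ** B + A ** (C :: mat3)"
  "(B + C) ** A = B ** A + C ** (A :: mat3)"
  by (simp_all add: matrix_matrix_mult_def vec_eq_iff algebra_simps sum.distrib)

lemma Sym3_smat: "A \<in> Sym3 \<Longrightarrow> smat c A \<in> Sym3"
  by (simp add: Sym3_def smat_def transpose_def vec_eq_iff)

lemma linear_form_congruent:
  assumes "linear_form F"
  shows "linear_form (\<lambda>X. F (h ** X ** k))"
  using assms by (simp add: linear_form_def matrix_add_rdistrib' smat_mult)

text \<open>Right multiplication acts on each row by the injective map \<open>transpose P\<close>,
  which preserves the dimension of the row space.\<close>

lemma rank_mult_invertible_right:
  fixes A :: "'a::field^'n^'m"
  assumes "invertible P"
  shows "rank (A ** P) = rank A"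
proof -
  obtain Q where "P ** Q = mat 1" using assms by (auto simp: invertible_def)
  then have inj: "inj ((*v) (transpose P))"
    by (intro injI) (metis matrix_transpose_mul matrix_vector_mul_assoc matrix_vector_mul_lid transpose_mat)
  have rows: "rows (A ** P) = (*v) (transpose P) ` rows A"
  proof -
    have "row i (A ** P) = transpose P *v row i A" for i
      by (simp add: vec_eq_iff row_def matrix_matrix_mult_def matrix_vector_mult_def transpose_def mult.commute)
    then show ?thesis by (auto simp: rows_def)
  qed
  show ?thesis
    unfolding row_rank_def_gen rows
    using inj by (intro vec.dim_image_eq matrix_vector_mul_linear_gen) (auto intro: inj_on_subset)
qed

lemma rank_mult_le_right:
  fixes A :: "'a::field^'n^'m"
  shows "rank (P ** A) \<le> rank A"
proof -
  have "row i (P ** A) = (\<Sum>j\<in>UNIV. P $ i $ j *s row j A)" for i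
    by (simp add: vec_eq_iff row_def matrix_matrix_mult_def)
  then have "rows (P ** A) \<subseteq> vec.span (rows A)"
    unfolding rows_def by (fastforce intro!: vec.span_sum vec.span_scale intro: vec.span_base)
  then show ?thesis unfolding row_rank_def_gen by (rule vec.dim_mono)
qed

lemma rank_mult_invertible_left:
  fixes A :: "'a::field^'n^'m"
  assumes "invertible P"
  shows "rank (P ** A) = rank A"
proof (rule antisym)
  obtain Q where "Q ** P = mat 1" using assms by (auto simp: invertible_def)
  then show "rank A \<le> rank (P ** A)"
    using rank_mult_le_right [of Q "P ** A"] by (simp add: matrix_mul_assoc)
qed (rule rank_mult_le_right)

text \<open>For the trace pairing, congruence by \<open>g\<close> on the net is adjoint to the map
  sending \<open>X\<close> to \<open>g ** X ** transpose g\<close>. This adjoint transports polar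
  matrices and the data matrix \<open>S\<close>.\<close>

lemma trace_congruent: "trace (transpose g ** M ** g ** X) = trace (M ** (g ** X ** transpose g))"
  for g M X :: "'a::comm_ring_1^'n^'n"
  using trace_mul_sym [of "transpose g" "M ** g ** X"] by (simp add: matrix_mul_assoc)

lemma trace_congruent': "trace (X ** (transpose g ** M ** g)) = trace (g ** X ** transpose g ** M)"
  for g M X :: "'a::comm_ring_1^'n^'n"
  unfolding trace_mul_sym [of X] trace_congruent by (rule trace_mul_sym)

lemma invertible_transpose: "invertible A \<Longrightarrow> invertible (transpose A)"
  for A :: "'a::field^'n^'n"
  by (metis invertible_def matrix_transpose_mul transpose_mat)

text \<open>Inverses return to those of the original net by the same adjoint map as polar matrices,
  so both halves of the base locus are transported together.\<close>

lemma matrix_inv_congruent: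
  fixes g M :: "'a::field^'n^'n"
  assumes "invertible g" "invertible M"
  shows "g ** matrix_inv (transpose g ** M ** g) ** transpose g = matrix_inv M"
proof -
  have inv: "invertible (transpose g ** M ** g)"
    using assms by (intro invertible_mult invertible_transpose)
  let ?T = "transpose g"
  have T: "matrix_inv ?T ** ?T = mat 1" using assms(1) by (intro matrix_inv_left invertible_transpose)
  have "M ** (g ** matrix_inv (?T ** M ** g) ** ?T) =
      (matrix_inv ?T ** ?T) ** M ** g ** matrix_inv (?T ** M ** g) ** ?T"
    by (simp add: T matrix_mul_assoc)
  also have "\<dots> = matrix_inv ?T ** ((?T ** M ** g) ** matrix_inv (?T ** M ** g)) ** ?T"
    by (simp only: matrix_mul_assoc)
  also have "\<dots> = mat 1"
    by (simp add: matrix_inv_right [OF inv] T)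
  finally show ?thesis by (simp add: matrix_inv_eqI)
qed

lemma invertible_congruent_iff:
  fixes g M :: "'a::field^'n^'n"
  assumes "invertible g"
  shows "invertible (transpose g ** M ** g) \<longleftrightarrow> invertible M"
  using assms by (simp add: invertible_det_nz det_mul det_transpose)

lemma critical_points_congruent:
  assumes g: "invertible g"
  shows "critical_points ((\<lambda>M. transpose g ** M ** g) ` L) S =
    (\<lambda>M. transpose g ** M ** g) ` critical_points L (g ** S ** transpose g)"
proof -
  let ?c = "\<lambda>M. transpose g ** M ** g"
  have "?c M \<in> critical_points (?c ` L) S \<longleftrightarrow> M \<in> critical_points L (g ** S ** transpose g)"
    if "M \<in> L" for M
  proof (cases "invertible M")
    case True
    have "trace (matrix_inv (?c M) ** ?c N) = trace (matrix_inv M ** N)" for N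
      by (simp only: trace_congruent' matrix_inv_congruent [OF g True])
    moreover have "trace (S ** ?c N) = trace (g ** S ** transpose g ** N)" for N
      by (rule trace_congruent')
    ultimately show ?thesis
      using that True by (simp add: critical_points_def invertible_congruent_iff [OF g])
  next
    case False
    then show ?thesis by (simp add: critical_points_def invertible_congruent_iff [OF g])
  qed
  moreover have "critical_points (?c ` L) S \<subseteq> ?c ` L" by (auto simp: critical_points_def)
  moreover have "critical_points L (g ** S ** transpose g) \<subseteq> L" by (auto simp: critical_points_def)
  ultimately show ?thesis by blast
qed


section \<open>The net \<open>F*\<close>\<close>

definition F_star_mat :: "complex \<Rightarrow> complex \<Rightarrow> complex \<Rightarrow> mat3" where
  "F_star_mat a b c = vector [vector [a, b, 0], vector [b, c, 0], vector [0, 0, c]]"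

lemma F_star_net_eq: "F_star_net = {F_star_mat a b c | a b c. True}"
proof -
  have "M \<in> F_star_net \<longleftrightarrow> (\<exists>a b c. M = F_star_mat a b c)" for M
    unfolding F_star_net_def cmat.span_insert F_star_mat_def
    by (simp add: vec_eq_iff forall_3 smat_def)
  then show ?thesis by blast
qed

lemma F_star_mat_in_net [simp]: "F_star_mat a b c \<in> F_star_net"
  by (auto simp: F_star_net_eq)

lemma F_star_mat_Sym3: "F_star_mat a b c \<in> Sym3"
  by (simp add: F_star_mat_def Sym3_iff)

lemma det_F_star_mat: "det (F_star_mat a b c) = c * (a * c - b\<^sup>2)"
  by (simp add: F_star_mat_def det_3 algebra_simps power2_eq_square)

lemma F_star_mat_eq_iff: "F_star_mat a b c = F_star_mat a' b' c' \<longleftrightarrow> a = a' \<and> b = b' \<and> c = c'"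
  by (auto simp: F_star_mat_def vec_eq_iff forall_3)

lemma mat3_mult_eq_1_iff:
  fixes A B :: mat3
  shows "A ** B = mat 1 \<longleftrightarrow>
    (\<forall>i j. A $ i $ 1 * B $ 1 $ j + A $ i $ 2 * B $ 2 $ j + A $ i $ 3 * B $ 3 $ j = (if i = j then 1 else 0))"
  by (simp add: vec_eq_iff matrix_matrix_mult_def sum_3 mat_def)

lemma inverse_F_star_mat:
  assumes "c \<noteq> 0" "D = a * c - b\<^sup>2" "D \<noteq> 0"
  shows "F_star_mat a b c **
    vector [vector [c / D, - b / D, 0], vector [- b / D, a / D, 0], vector [0, 0, 1 / c]] = mat 1"
  using assms
  by (simp add: mat3_mult_eq_1_iff F_star_mat_def forall_3 field_simps power2_eq_square)

lemma trace_F_star_mat: "trace (X ** F_star_mat a b c) =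
    a * X $ 1 $ 1 + b * (X $ 1 $ 2 + X $ 2 $ 1) + c * (X $ 2 $ 2 + X $ 3 $ 3)"
  by (simp add: trace_def sum_3 matrix_matrix_mult_def F_star_mat_def algebra_simps)

lemma trace_F_star_net_iff:
  assumes "X \<in> Sym3" "Y \<in> Sym3"
  shows "(\<forall>N\<in>F_star_net. trace (X ** N) = trace (Y ** N)) \<longleftrightarrow>
    X $ 1 $ 1 = Y $ 1 $ 1 \<and> X $ 1 $ 2 = Y $ 1 $ 2 \<and> X $ 2 $ 2 + X $ 3 $ 3 = Y $ 2 $ 2 + Y $ 3 $ 3"
    (is "?L \<longleftrightarrow> ?R")
proof
  assume ?L
  then have "trace (X ** F_star_mat a b c) = trace (Y ** F_star_mat a b c)" for a b c by simp
  from this [of 1 0 0] this [of 0 1 0] this [of 0 0 1] show ?R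
    using assms by (simp add: trace_F_star_mat Sym3_iff)
next
  assume ?R
  then show ?L using assms by (auto simp: F_star_net_eq trace_F_star_mat Sym3_iff)
qed

text \<open>For the inverse \<open>X\<close> with \<open>X11 = u\<close> and \<open>X12 = v\<close>,
  \<open>d\<close> is the determinant of the upper left block. Then
  \<open>X22 = (v\<^sup>2 + d) / u\<close> and \<open>X33 = 1 / c = d / u\<close>, so the prescribed
  sum \<open>w\<close> gives \<open>u * w - v\<^sup>2 = 2 * d\<close>. The block determinant
  \<open>a * c - b\<^sup>2\<close> of the matrix itself is \<open>1 / d\<close>.\<close>

lemma F_star_critical_equations_iff:
  fixes u v w a b c :: complex
  assumes u: "u \<noteq> 0" and uw: "u * w - v\<^sup>2 \<noteq> 0"
  defines "d \<equiv> (u * w - v\<^sup>2) / 2"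
  shows "c \<noteq> 0 \<and> a * c - b\<^sup>2 \<noteq> 0 \<and> c / (a * c - b\<^sup>2) = u \<and> - b / (a * c - b\<^sup>2) = v \<and>
      a / (a * c - b\<^sup>2) + 1 / c = w \<longleftrightarrow>
    a = (u * w + v\<^sup>2) / (2 * u * d) \<and> b = - v / d \<and> c = u / d" (is "?L \<longleftrightarrow> ?R")
proof -
  have d: "d \<noteq> 0" "u * w = 2 * d + v\<^sup>2" using uw unfolding d_def by (simp_all add: field_simps)
  have w: "w = (2 * d + v\<^sup>2) / u" using d(2) u by (simp add: field_simps)
  have a: "(u * w + v\<^sup>2) / (2 * u * d) = (d + v\<^sup>2) / (u * d)"
    using u d(1) by (simp add: d(2) field_simps)
  show ?thesis
  proof
    assume R: ?R
    then have R': "a = (d + v\<^sup>2) / (u * d)" "b = - v / d" "c = u / d"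
      unfolding a by blast+
    have "a * c = (d + v\<^sup>2) / d\<^sup>2" "b\<^sup>2 = v\<^sup>2 / d\<^sup>2"
      using u unfolding R' by (simp_all add: power2_eq_square)
    then have D: "a * c - b\<^sup>2 = 1 / d"
      using d(1) by (simp add: power2_eq_square add_divide_distrib)
    show ?L
      using d(1) u unfolding D w unfolding R' by (simp add: field_simps)
  next
    assume L: ?L
    define D where "D = a * c - b\<^sup>2"
    have c: "c = u * D" and b: "b = - v * D" and D: "D \<noteq> 0" and w': "a / D + 1 / c = w"
      using L by (auto simp: D_def field_simps)
    have "a * u * D - v\<^sup>2 * D\<^sup>2 = D" using D_def c b by (simp add: power2_eq_square mult_ac)
    then have "D * (a * u) = D * (1 + v\<^sup>2 * D)" by (simp add: algebra_simps power2_eq_square)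
    then have au: "a * u = 1 + v\<^sup>2 * D" using D by simp
    have "w * u * D = a * u + 1"
      using D u by (simp add: w' [symmetric] c field_simps)
    then have "(2 * d + v\<^sup>2) * D = 2 + v\<^sup>2 * D" using au d(2) by (simp add: mult.commute)
    then have "2 * (d * D) = 2 * 1" by (simp add: algebra_simps)
    then have Dd: "D = 1 / d" using d(1) by (simp add: field_simps)
    have "a = (1 + v\<^sup>2 * D) / u" using u au by (simp add: eq_divide_eq)
    also have "\<dots> = (d + v\<^sup>2) / (u * d)"
      unfolding Dd using u d(1) by (simp add: field_simps)
    finally show ?R unfolding a using c b Dd by simp
  qed
qed

lemma critical_points_F_star_net:
  assumes S: "S \<in> Sym3" and "S $ 1 $ 1 \<noteq> 0"
    and "S $ 1 $ 1 * (S $ 2 $ 2 + S $ 3 $ 3) - (S $ 1 $ 2)\<^sup>2 \<noteq> 0"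
  shows "\<exists>M. critical_points F_star_net S = {M}"
proof -
  let ?u = "S $ 1 $ 1" and ?v = "S $ 1 $ 2" and ?w = "S $ 2 $ 2 + S $ 3 $ 3"
  let ?d = "(?u * ?w - ?v\<^sup>2) / 2"
  have crit: "F_star_mat a b c \<in> critical_points F_star_net S \<longleftrightarrow>
    c \<noteq> 0 \<and> a * c - b\<^sup>2 \<noteq> 0 \<and> c / (a * c - b\<^sup>2) = ?u \<and> - b / (a * c - b\<^sup>2) = ?v \<and>
      a / (a * c - b\<^sup>2) + 1 / c = ?w" for a b c
  proof (cases "c \<noteq> 0 \<and> a * c - b\<^sup>2 \<noteq> 0")
    case True
    let ?D = "a * c - b\<^sup>2"
    let ?X = "vector [vector [c / ?D, - b / ?D, 0], vector [- b / ?D, a / ?D, 0], vector [0, 0, 1 / c]] :: mat3"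
    have X: "matrix_inv (F_star_mat a b c) = ?X"
      using True by (intro matrix_inv_eqI inverse_F_star_mat) auto
    have "?X \<in> Sym3" by (simp add: Sym3_iff)
    moreover have "invertible (F_star_mat a b c)"
      using True by (simp add: invertible_det_nz det_F_star_mat)
    ultimately show ?thesis
      using True by (simp add: critical_points_def X trace_F_star_net_iff [OF _ S])
  next
    case False
    then show ?thesis by (auto simp: critical_points_def invertible_det_nz det_F_star_mat)
  qed
  have "critical_points F_star_net S \<subseteq> F_star_net" by (auto simp: critical_points_def)
  then have "critical_points F_star_net S =
    {F_star_mat ((?u * ?w + ?v\<^sup>2) / (2 * ?u * ?d)) (- ?v / ?d) (?u / ?d)}"
    using crit [unfolded F_star_critical_equations_iff [OF assms(2,3)]]
    by (auto simp: F_star_net_eq F_star_mat_eq_iff)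
  then show ?thesis ..
qed

lemma ml_degree_congruent_F_star:
  assumes g: "invertible g"
  shows "has_ml_degree ((\<lambda>M. transpose g ** M ** g) ` F_star_net) 1"
proof -
  let ?c = "\<lambda>M. transpose g ** M ** g" and ?h = "\<lambda>S. g ** S ** transpose g"
  have lin: "linear_form (\<lambda>S. ?h S $ i $ j)" for i j
    using linear_form_congruent [of "\<lambda>X. X $ i $ j"] by (simp add: linear_form_def smat_def)
  obtain u where u: "\<And>S. S \<in> Sym3 \<Longrightarrow> poly_eval u S = ?h S $ 1 $ 1"
    using ex_poly_linear_form [OF lin] by blast
  obtain v where v: "\<And>S. S \<in> Sym3 \<Longrightarrow> poly_eval v S = ?h S $ 1 $ 2"
    using ex_poly_linear_form [OF lin] by blast
  obtain w1 where w1: "\<And>S. S \<in> Sym3 \<Longrightarrow> poly_eval w1 S = ?h S $ 2 $ 2"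
    using ex_poly_linear_form [OF lin] by blast
  obtain w2 where w2: "\<And>S. S \<in> Sym3 \<Longrightarrow> poly_eval w2 S = ?h S $ 3 $ 3"
    using ex_poly_linear_form [OF lin] by blast
  \<comment> \<open>\<open>q\<close> is nonzero at \<open>S\<close> exactly when both inequalities
    assumed in \<open>critical_points_F_star_net\<close> hold for \<open>?h S\<close>.\<close>
  define q where "q = u * (u * (w1 + w2) - v ^ 2)"
  have q: "poly_eval q S = ?h S $ 1 $ 1 *
      (?h S $ 1 $ 1 * (?h S $ 2 $ 2 + ?h S $ 3 $ 3) - (?h S $ 1 $ 2)\<^sup>2)" if "S \<in> Sym3" for S
    using that by (simp add: q_def poly_eval_mult poly_eval_diff poly_eval_add poly_eval_power u v w1 w2)
  have "q \<noteq> 0"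
  proof -
    let ?k = "matrix_inv g"
    \<comment> \<open>The preimage of the identity under \<open>?h\<close>, where \<open>q\<close>
      takes the value \<open>1 * (1 * (1 + 1) - 0) = 2\<close>.\<close>
    let ?S = "?k ** mat 1 ** transpose ?k"
    have "?S \<in> Sym3" by (rule congruent_Sym3') (simp add: Sym3_def transpose_mat)
    moreover have "?h ?S = mat 1"
    proof -
      have "?h ?S = (g ** ?k) ** transpose (g ** ?k)"
        by (simp add: matrix_mul_assoc matrix_transpose_mul)
      then show ?thesis by (simp add: matrix_inv_right [OF g] transpose_mat)
    qed
    ultimately have "poly_eval q ?S = 2" using q by (simp add: mat_def)
    then show ?thesis by auto
  qed
  moreover have "\<exists>M. critical_points (?c ` F_star_net) S = {M}"
    if S: "S \<in> Sym3" and "poly_eval q S \<noteq> 0" for S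
  proof -
    have "\<exists>M. critical_points F_star_net (?h S) = {M}"
      using that q [OF S] by (intro critical_points_F_star_net congruent_Sym3') auto
    then show ?thesis unfolding critical_points_congruent [OF g] by auto
  qed
  ultimately show ?thesis
    unfolding has_ml_degree_def by (metis One_nat_def card_1_singleton_iff finite.simps)
qed


section \<open>The base locus\<close>

definition F_star_base :: mat3 where
  "F_star_base = vector [vector [0, 0, 0], vector [0, 1, 0], vector [0, 0, - 1]]"

lemma F_star_base_Sym3: "F_star_base \<in> Sym3"
  by (simp add: F_star_base_def Sym3_iff)

lemma rank_F_star_base: "rank F_star_base = 2"
proof -
  let ?e = "vector [0, 1, 0] :: complex^3" and ?f = "vector [0, 0, - 1] :: complex^3"
  have "row 1 F_star_base = 0" "row 2 F_star_base = ?e" "row 3 F_star_base = ?f"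
    by (simp_all add: F_star_base_def row_def vec_eq_iff forall_3)
  moreover have "rows F_star_base = (\<lambda>i. row i F_star_base) ` UNIV" by (auto simp: rows_def)
  ultimately have "rows F_star_base = {0, ?e, ?f}" by (simp add: UNIV_3)
  then have "rank F_star_base = vec.dim {?e, ?f}"
    by (metis row_rank_def_gen vec.dim_span vec.span_insert_0)
  moreover have "?e \<notin> vec.span {?f}" "?f \<notin> vec.span {}"
    by (auto simp: vec.span_breakdown_eq vec_eq_iff forall_3)
  ultimately show ?thesis by (simp add: vec.dim_insert)
qed

text \<open>This arc of inverses arises by imposing \<open>b\<^sup>2 = 2 * a * c\<close>, the condition for
  \<open>X22 = - X33\<close> in the inverse, and letting \<open>b\<close> tend to infinity.\<close>

definition F_star_arc :: "complex \<Rightarrow> mat3" where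
  "F_star_arc t = vector [vector [t\<^sup>2 / 2, - t, 0], vector [- t, 1, 0], vector [0, 0, - 1]]"

lemma F_star_arc_0: "F_star_arc 0 = F_star_base"
  by (simp add: F_star_arc_def F_star_base_def)

text \<open>The normalisation is \<open>c = - 1\<close> and \<open>b = - 2 / t\<close>, hence
  \<open>a = b\<^sup>2 / (2 * c) = - 2 / t\<^sup>2\<close>. The block determinant is
  \<open>- 2 / t\<^sup>2\<close> as well, and dividing by it leaves entries polynomial in
  \<open>t\<close>, which extend to \<open>t = 0\<close>.\<close>

lemma F_star_arc_inverse:
  "t \<noteq> 0 \<Longrightarrow> F_star_mat (- 2 / t\<^sup>2) (- 2 / t) (- 1) ** F_star_arc t = mat 1"
  by (simp add: mat3_mult_eq_1_iff F_star_mat_def F_star_arc_def forall_3 field_simps power2_eq_square)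

text \<open>A form in the ideal of \<open>proj_inverse\<close> can thus be found by checking it on
  actual inverses.\<close>

lemma vanishing_ideal_subset_closure: "vanishing_ideal X \<subseteq> vanishing_ideal (zariski_closure X)"
  unfolding vanishing_ideal_def zariski_closure_def zero_locus_def by blast

context
  fixes g :: mat3
  assumes g: "invertible g"
begin

abbreviation "cnet \<equiv> (\<lambda>M. transpose g ** M ** g) ` F_star_net"
abbreviation "to_std X \<equiv> g ** X ** transpose g"
abbreviation "from_std Y \<equiv> matrix_inv g ** Y ** transpose (matrix_inv g)"

lemma to_std_from_std: "to_std (from_std Y) = Y"
proof -
  have "to_std (from_std Y) = (g ** matrix_inv g) ** Y ** transpose (g ** matrix_inv g)"
    by (simp add: matrix_mul_assoc matrix_transpose_mul)
  then show ?thesis by (simp add: matrix_inv_right [OF g] transpose_mat)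
qed

lemma from_std_to_std: "from_std (to_std X) = X"
proof -
  have "from_std (to_std X) = (matrix_inv g ** g) ** X ** transpose (matrix_inv g ** g)"
    by (simp add: matrix_mul_assoc matrix_transpose_mul)
  then show ?thesis by (simp add: matrix_inv_left [OF g] transpose_mat)
qed

lemma inverse_congruent_F_star:
  assumes "A \<in> cnet" "det A \<noteq> 0"
  obtains a b c where "F_star_mat a b c ** to_std (matrix_inv A) = mat 1" "A \<in> Sym3"
    "A ** matrix_inv A = mat 1"
proof -
  obtain a b c where A: "A = transpose g ** F_star_mat a b c ** g"
    using assms(1) by (auto simp: F_star_net_eq)
  have inv: "invertible A" using assms(2) by (simp add: invertible_det_nz)
  then have M: "invertible (F_star_mat a b c)" using A invertible_congruent_iff [OF g] by blast
  have "F_star_mat a b c ** to_std (matrix_inv A) = mat 1"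
    unfolding A matrix_inv_congruent [OF g M] by (rule matrix_inv_right [OF M])
  then show ?thesis
    using that matrix_inv_right [OF inv] congruent_Sym3 [OF F_star_mat_Sym3] A by blast
qed

lemma inverse_arc_congruent:
  assumes "t \<noteq> 0"
  obtains A where "A \<in> cnet" "det A \<noteq> 0" "matrix_inv A = from_std (F_star_arc t)"
proof -
  let ?M = "F_star_mat (- 2 / t\<^sup>2) (- 2 / t) (- 1)"
  let ?A = "transpose g ** ?M ** g"
  have M: "invertible ?M" using F_star_arc_inverse [OF assms] by (auto simp: invertible_right_inverse)
  then have "invertible ?A" by (simp add: invertible_congruent_iff [OF g])
  moreover have "to_std (matrix_inv ?A) = F_star_arc t"
    unfolding matrix_inv_congruent [OF g M]
    by (rule matrix_inv_eqI [OF F_star_arc_inverse [OF assms]])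
  then have "matrix_inv ?A = from_std (F_star_arc t)" by (metis from_std_to_std)
  ultimately show ?thesis by (intro that [of ?A]) (auto simp: invertible_det_nz)
qed

lemma polar_congruent_F_star:
  "N \<in> polar_net cnet \<longleftrightarrow> N \<in> Sym3 \<and> to_std N $ 1 $ 1 = 0 \<and> to_std N $ 1 $ 2 = 0 \<and>
    to_std N $ 2 $ 2 + to_std N $ 3 $ 3 = 0"
proof (cases "N \<in> Sym3")
  case True
  have 0: "(0 :: mat3) \<in> Sym3" by (simp add: Sym3_iff)
  \<comment> \<open>Polarity is the comparison of traces with the zero matrix, so it falls under the
    criterion used for the critical equations.\<close>
  have "N \<in> polar_net cnet \<longleftrightarrow> (\<forall>M\<in>F_star_net. trace (to_std N ** M) = trace (0 ** M))"
  proof -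
    have "trace (0 ** M) = 0" for M :: mat3 by (simp add: trace_def)
    then show ?thesis
      using True by (simp add: polar_net_def trace_congruent trace_mul_sym [of _ "to_std N"])
  qed
  then show ?thesis
    using True trace_F_star_net_iff [OF congruent_Sym3' [OF True] 0] by simp
qed (simp add: polar_net_def)

lemma base_point_Sym3: "from_std F_star_base \<in> Sym3"
  by (intro congruent_Sym3' F_star_base_Sym3)

lemma base_point_nonzero: "from_std F_star_base \<noteq> 0"
proof
  assume "from_std F_star_base = 0"
  then have "F_star_base = to_std 0" by (metis to_std_from_std)
  then have "F_star_base $ 2 $ 2 = 0" by simp
  then show False by (simp add: F_star_base_def)
qed

lemma base_point_in_polar: "from_std F_star_base \<in> polar_net cnet"
  unfolding polar_congruent_F_star to_std_from_std
  using base_point_Sym3 by (simp add: F_star_base_def)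

lemma rank_base_point: "rank (from_std F_star_base) = 2"
proof -
  have "invertible (matrix_inv g)"
    using matrix_inv_left [OF g] by (auto simp: invertible_right_inverse)
  then show ?thesis
    by (simp add: rank_mult_invertible_left rank_mult_invertible_right invertible_transpose
        rank_F_star_base del: transpose_matrix_vector)
qed

text \<open>A polynomial vanishing on the inverses vanishes along the arc for \<open>t\<close>
  nonzero, and by continuity at \<open>t = 0\<close>; the scalar \<open>k\<close> runs through the
  representatives of the point.\<close>

lemma base_point_in_proj_inverse: "proj_point (from_std F_star_base) \<in> proj_inverse cnet"
proof -
  let ?N = "from_std F_star_base"
  let ?I = "{matrix_inv A | A. A \<in> cnet \<and> det A \<noteq> 0}"
  have "proj_point ?N \<in> proj Sym3"
    using base_point_Sym3 base_point_nonzero by (auto simp: proj_def)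
  moreover have "poly_eval f (smat k ?N) = 0" if f: "f \<in> vanishing_ideal (proj ?I)" and k: "k \<noteq> 0" for f k
  proof -
    let ?p = "\<lambda>t. poly_eval f (smat k (from_std (F_star_arc t)))"
    have zero: "?p t = 0" if t: "t \<noteq> 0" for t
    proof -
      obtain A where A: "A \<in> cnet" "det A \<noteq> 0" "matrix_inv A = from_std (F_star_arc t)"
        using inverse_arc_congruent [OF t] .
      have "A ** matrix_inv A = mat 1"
        using A(2) by (intro matrix_inv_right) (simp add: invertible_det_nz)
      moreover have "(mat 1 :: mat3) $ 1 $ 1 \<noteq> 0" by (simp add: mat_def)
      ultimately have "matrix_inv A \<noteq> 0" by (metis times0_right zero_index)
      moreover have "matrix_inv A \<in> ?I" using A(1,2) by blast
      ultimately have "proj_point (matrix_inv A) \<in> proj ?I" unfolding proj_def by blast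
      moreover have "smat k (matrix_inv A) \<in> proj_point (matrix_inv A)" using k by (auto simp: proj_point_def)
      ultimately show ?thesis using f A(3) by (auto simp: vanishing_ideal_def)
    qed
    have "\<forall>i j. isCont (\<lambda>t. F_star_arc t $ i $ j) 0"
      unfolding forall_3 F_star_arc_def vector_3 by (intro conjI continuous_intros) auto
    then have "isCont ?p 0"
      by (intro continuous_poly_eval)
        (auto simp: smat_def matrix_matrix_mult_def sum_3 intro!: continuous_intros)
    then have "?p \<midarrow>0\<rightarrow> ?p 0" by (simp add: isCont_def)
    moreover have "?p \<midarrow>0\<rightarrow> 0"
      by (rule Lim_transform_eventually [OF tendsto_const])
        (auto simp: eventually_at_filter zero intro!: always_eventually)
    ultimately have "?p 0 = 0" by (rule LIM_unique)
    then show ?thesis by (simp add: F_star_arc_0)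
  qed
  ultimately show ?thesis
    unfolding proj_inverse_def zariski_closure_def zero_locus_def by (auto simp: proj_point_def)
qed

text \<open>In standard coordinates, the entries \<open>X31\<close> and \<open>X32\<close> vanish on the inverse net, and
  \<open>X11\<close>, \<open>X12\<close>, \<open>X22 + X33\<close> vanish on the polar net; these five forms span the linear forms
  vanishing at the base point.\<close>

lemma linear_form_in_base_locus:
  assumes p: "linear_form (poly_eval p)" "poly_eval p (from_std F_star_base) = 0"
  shows "p \<in> ml_base_locus cnet"
proof -
  \<comment> \<open>\<open>?\<pi>\<close> keeps the \<open>X13\<close> and \<open>X23\<close> parts
    of a matrix in standard coordinates, so \<open>?F\<close> is the part of \<open>p\<close> to be
    assigned to the inverses. Row 3 is read because row 3 of \<open>F_star_mat a b c\<close> is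
    \<open>(0, 0, c)\<close>, so the product with the inverse determines exactly these
    entries.\<close>
  let ?\<pi> = "\<lambda>Y. smat (Y $ 3 $ 1) (coord_basis X13) + smat (Y $ 3 $ 2) (coord_basis X23)"
  let ?F = "\<lambda>X. poly_eval p (from_std (?\<pi> (to_std X)))"
  have \<pi>: "?\<pi> (A + B) = ?\<pi> A + ?\<pi> B" "?\<pi> (smat k A) = smat k (?\<pi> A)" for A B k
    by (simp_all add: vec_eq_iff forall_3 smat_def)
  have lin: "linear_form (\<lambda>Y. poly_eval p (from_std Y))" by (rule linear_form_congruent [OF p(1)])
  then have "linear_form (\<lambda>Y. poly_eval p (from_std (?\<pi> Y)))"
    unfolding linear_form_def \<pi> by simp
  then have linF: "linear_form ?F" by (rule linear_form_congruent)
  then obtain l where l: "\<And>A. A \<in> Sym3 \<Longrightarrow> poly_eval l A = ?F A"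
    using ex_poly_linear_form by blast
  have "l \<in> vanishing_ideal (proj_inverse cnet)"
  proof -
    have "poly_eval l (smat k (matrix_inv A)) = 0" if A: "A \<in> cnet" "det A \<noteq> 0" for A k
    proof -
      let ?X = "to_std (matrix_inv A)"
      obtain a b c where X: "F_star_mat a b c ** ?X = mat 1" and A': "A \<in> Sym3" "A ** matrix_inv A = mat 1"
        using inverse_congruent_F_star [OF A] .
      \<comment> \<open>The third equation forces \<open>c\<close> to be nonzero, so the first two
        can be divided by it.\<close>
      have "c * ?X $ 3 $ 1 = 0" "c * ?X $ 3 $ 2 = 0" "c * ?X $ 3 $ 3 = 1"
        using X unfolding mat3_mult_eq_1_iff by (simp_all add: forall_3 F_star_mat_def)
      then have "?X $ 3 $ 1 = 0" "?X $ 3 $ 2 = 0" by auto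
      then have "?\<pi> ?X = 0" by simp
      then have "?F (matrix_inv A) = 0" using linear_form_smat [OF lin, of 0 0] by simp
      then show ?thesis
        using l [OF Sym3_smat [OF inverse_Sym3 [OF A']], of k] linear_form_smat [OF linF, of k]
        by (simp only: mult_zero_right)
    qed
    then have "l \<in> vanishing_ideal (proj {matrix_inv A | A. A \<in> cnet \<and> det A \<noteq> 0})"
      by (auto simp: vanishing_ideal_def proj_def proj_point_def)
    then show ?thesis
      using vanishing_ideal_subset_closure unfolding proj_inverse_def by blast
  qed
  moreover have "p - l \<in> vanishing_ideal (proj (polar_net cnet))"
  proof -
    have "poly_eval (p - l) (smat k N) = 0" if N: "N \<in> polar_net cnet" for N k
    proof -
      let ?Y = "to_std N"
      have sym: "N \<in> Sym3" and Y: "?Y $ 1 $ 1 = 0" "?Y $ 1 $ 2 = 0" "?Y $ 2 $ 2 + ?Y $ 3 $ 3 = 0"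
        using N by (simp_all add: polar_congruent_F_star)
      have "?Y \<in> Sym3" using sym by (rule congruent_Sym3')
      \<comment> \<open>Modulo the \<open>X13\<close> and \<open>X23\<close> parts, a polar matrix
        is a multiple of the base matrix, and \<open>p\<close> vanishes there; hence
        \<open>p\<close> and \<open>?F\<close> agree on the polar net.\<close>
      then have "?Y = ?\<pi> ?Y + smat (?Y $ 2 $ 2) F_star_base"
        using Y unfolding Sym3_iff
        by (simp add: vec_eq_iff forall_3 smat_def F_star_base_def add_eq_0_iff)
      then have "poly_eval p (from_std ?Y) = ?F N + ?Y $ 2 $ 2 * poly_eval p (from_std F_star_base)"
        by (metis linear_form_add [OF lin] linear_form_smat [OF lin])
      then have "poly_eval p N = ?F N" by (simp add: p(2) from_std_to_std)
      then show ?thesis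
        by (simp only: poly_eval_diff l [OF Sym3_smat [OF sym]] linear_form_smat [OF p(1)]
            linear_form_smat [OF linF] diff_self)
    qed
    then show ?thesis by (auto simp: vanishing_ideal_def proj_def proj_point_def)
  qed
  ultimately show ?thesis
    unfolding ml_base_locus_def ideal_sum_def
    by (intro CollectI exI [of _ l] exI [of _ "p - l"]) simp
qed

lemma ml_base_locus_congruent_F_star:
  "ml_base_locus cnet = vanishing_ideal {proj_point (from_std F_star_base)}"
proof (rule antisym)
  let ?N = "from_std F_star_base"
  have "proj_point ?N \<in> proj (polar_net cnet)"
    using base_point_in_polar base_point_nonzero by (auto simp: proj_def)
  then show "ml_base_locus cnet \<subseteq> vanishing_ideal {proj_point ?N}"
    using base_point_in_proj_inverse
    by (auto simp: ml_base_locus_def ideal_sum_def vanishing_ideal_def poly_eval_add)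
next
  let ?N = "from_std F_star_base"
  obtain l where l: "linear_form (poly_eval l)" "poly_eval l ?N = 1"
    using ex_linear_form_eq_1 [OF base_point_Sym3 base_point_nonzero] .
  \<comment> \<open>These linear forms vanish at \<open>?N\<close> because \<open>l\<close> has the
    value 1 there, and they generate its ideal.\<close>
  have "cvar v - cconst (entry v ?N) * l \<in> ml_base_locus cnet" for v
  proof (rule linear_form_in_base_locus)
    show "linear_form (poly_eval (cvar v - cconst (entry v ?N) * l))"
      using l(1) by (simp add: linear_form_def poly_eval_diff poly_eval_mult mon_eval_single
          entry_add entry_smat algebra_simps)
    show "poly_eval (cvar v - cconst (entry v ?N) * l) ?N = 0"
      by (simp add: poly_eval_diff poly_eval_mult mon_eval_single l(2))
  qed
  moreover have "poly_ideal (ml_base_locus cnet)"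
    unfolding ml_base_locus_def by (intro poly_ideal_ideal_sum poly_ideal_vanishing_ideal)
  ultimately show "vanishing_ideal {proj_point ?N} \<subseteq> ml_base_locus cnet"
    by (intro vanishing_ideal_point_subset)
qed

end

theorem proposition4p10:
  fixes L :: "(complex^3^3) set"
  assumes "net_of_conics L" and "type_F_star L"
  shows "(\<exists>N\<in>Sym3. rank N = 2 \<and> is_reduced_point (ml_base_locus L) (proj_point N))
         \<and> has_ml_degree L 1"
proof -
  obtain g :: mat3 where g: "invertible g" and L: "L = (\<lambda>M. transpose g ** M ** g) ` F_star_net"
    using assms(2) by (auto simp: type_F_star_def congruent_nets_def)
  show ?thesis
    unfolding L
    using ml_degree_congruent_F_star [OF g] base_point_Sym3 [OF g] rank_base_point [OF g]
      is_reduced_point_vanishing_ideal [OF base_point_Sym3 [OF g] base_point_nonzero [OF g]]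
    unfolding ml_base_locus_congruent_F_star [OF g, symmetric]
    by blast
qed

end
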